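(* (Global wellposedness.) There exists a unique $u\in C([0,\infty);L^\infty(\mathbb{R}^N))$ solving the initial-boundary value problem $$u_t(t,x)=\int_{\mathbb{R}^N}k\bigl(u(t,x),u(t,y)\bigr)\,[u(t,y)-u(t,x)]\,J(x-y)\,dy,\qquad t\ge0,\ x\in\Omega,$$ $$u(t,x)=\psi(x),\quad t\ge0,\ x\in\mathbb{R}^N\setminus\Omega,\qquad u(0,x)=u_0(x),\quad x\in\mathbb{R}^N.$$
   Context: Standing assumptions: $\Omega\subset\mathbb{R}^N$ is a bounded open set. $J:\mathbb{R}^N\to\mathbb{R}$ is nonnegative and integrable, with $J(z)>0$ for $|z|<1$ and $J(z)=0$ for $|z|\ge1$. $k:\mathbb{R}^2\to\mathbb{R}$ is nonnegative and locally Lipschitz in the sense that $|k(a,b)-k(a',b')|\le K(|a|+|a'|,|b|+|b'|)\,(|a-a'|+|b-b'|)$ for all real $a,a',b,b'$, where $K$ is nonnegative, nondecreasing and continuous. $u_0\in L^\infty(\mathbb{R}^N)$, $\psi\in L^\infty(\mathbb{R}^N\setminus\Omega)$, and $u_0=\psi$ on $\mathbb{R}^N\setminus\Omega$. A solution is understood as a function continuous in time with values in $L^\infty(\mathbb{R}^N)$, equal to $\psi$ outside $\Omega$, satisfying for $x\in\Omega$ (a.e.) $u(t,x)=u_0(x)+\int_0^t\int_{\mathbb{R}^N}k(u(s,x),u(s,y))[u(s,y)-u(s,x)]J(x-y)\,dy\,ds$. *)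

theory Defs
  imports "HOL-Analysis.Analysis" "HOL-Probability.Essential_Supremum"
begin

text \<open>
  Elements of \<open>L\<^sup>\<infinity>\<close> are handled through representatives: functions are identified when they
  agree almost everywhere. The norm is extended-real valued, so it is
  \<open>\<infinity>\<close> for measurable functions that are not essentially bounded.
\<close>

definition Linf_norm :: "'a measure \<Rightarrow> ('a \<Rightarrow> real) \<Rightarrow> ereal" where
  "Linf_norm M f = esssup M (\<lambda>x. ereal \<bar>f x\<bar>)"

definition Linf :: "'a measure \<Rightarrow> ('a \<Rightarrow> real) set" where
  "Linf M = {f \<in> borel_measurable M. Linf_norm M f < \<infinity>}"

definition C_Linf :: "'a measure \<Rightarrow> (real \<Rightarrow> 'a \<Rightarrow> real) set" where
  "C_Linf M = {u. (\<forall>t\<ge>0. u t \<in> Linf M) \<and>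
     (\<forall>t\<ge>0. ((\<lambda>s. Linf_norm M (\<lambda>x. u s x - u t x)) \<longlongrightarrow> 0) (at t within {0..}))}"

definition nonlocal_op ::
  "(real \<Rightarrow> real \<Rightarrow> real) \<Rightarrow> (real ^ 'n \<Rightarrow> real) \<Rightarrow> (real ^ 'n \<Rightarrow> real) \<Rightarrow> real ^ 'n \<Rightarrow> real" where
  "nonlocal_op k J w x = (LINT y|lebesgue. k (w x) (w y) * (w y - w x) * J (x - y))"

text \<open>
  For fixed \<open>x\<close> the time integral is sensitive to changing the representative of \<open>u s\<close> for
  every \<open>s\<close>, so the integral equation is read on a representative that is measurable in
  \<open>(t, x)\<close> jointly. Every element of \<open>C([0,\<infinity>); L\<^sup>\<infinity>)\<close> has one, and by Fubini the choice does
  not matter: two of them agree for almost every \<open>(t, x)\<close>.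
\<close>

definition joint_version :: "(real \<Rightarrow> real ^ 'n \<Rightarrow> real) \<Rightarrow> (real \<Rightarrow> real ^ 'n \<Rightarrow> real) \<Rightarrow> bool" where
  "joint_version u v \<longleftrightarrow>
     (\<lambda>(t, x). v t x) \<in> borel_measurable (lebesgue_on ({0..} \<times> UNIV)) \<and>
     (\<forall>t\<ge>0. AE x in lebesgue. v t x = u t x)"

text \<open>
  The evolution equation is understood in its time-integrated form. Under the hypotheses on \<open>k\<close>
  and \<open>J\<close> both integrals below converge absolutely for almost every \<open>x\<close>, since \<open>u\<close> is
  essentially bounded on bounded time intervals.
\<close>

definition is_solution ::
  "(real ^ 'n) set \<Rightarrow> (real \<Rightarrow> real \<Rightarrow> real) \<Rightarrow> (real ^ 'n \<Rightarrow> real) \<Rightarrow> (real ^ 'n \<Rightarrow> real) \<Rightarrow>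
   (real ^ 'n \<Rightarrow> real) \<Rightarrow> (real \<Rightarrow> real ^ 'n \<Rightarrow> real) \<Rightarrow> bool" where
  "is_solution \<Omega> k J \<psi> u0 u \<longleftrightarrow>
     u \<in> C_Linf lebesgue \<and>
     (\<forall>t\<ge>0. AE x in lebesgue. x \<notin> \<Omega> \<longrightarrow> u t x = \<psi> x) \<and>
     (AE x in lebesgue. u 0 x = u0 x) \<and>
     (\<exists>v. joint_version u v \<and>
        (\<forall>t\<ge>0. AE x in lebesgue. x \<in> \<Omega> \<longrightarrow>
           v t x = u0 x + (LINT s:{0..t}|lebesgue. nonlocal_op k J (v s) x)))"

end

theory Submission
  imports Defs
begin

text \<open>
  Clipping the arguments of \<open>k\<close> to a ball of radius \<open>M\<close> that contains the values of \<open>u0\<close> makes the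
  nonlinearity bounded and globally Lipschitz. The Picard map of the clipped equation is then a
  contraction by the factor 1/2 for the weighted norm \<open>sup exp (- 2 L t) \<bar>w (t, x)\<bar>\<close>, and for Borel data
  its fixed point solves the equation at every point. For fixed \<open>x\<close> the right-hand side is nonpositive
  wherever \<open>u (t, x) \<ge> M\<close> and nonnegative wherever \<open>u (t, x) \<le> - M\<close>, so the solution stays within
  \<open>[-M, M]\<close>, where clipping has no effect. For uniqueness, two solutions on \<open>[0, T]\<close> share a common
  bound \<open>R\<close>; clipping at \<open>R\<close> and passing to Borel versions, the same contraction estimate, now holding
  almost everywhere, halves the weighted distance arbitrarily often.
\<close>

section \<open>Reflection invariance and passage between Lebesgue and Borel integrals\<close>

lemma lborel_distr_reflect:
  fixes x :: "'a::euclidean_space"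
  shows "distr lborel borel (\<lambda>y. x - y) = lborel"
proof -
  have "density (distr lborel borel (\<lambda>y. x - y)) (\<lambda>_. 1) = lborel"
    using lborel_affine[of "-1" x, symmetric] by simp
  then show ?thesis
    by (simp add: density_1)
qed

text \<open>Applied to \<open>J\<close>, this makes every estimate of the integral of
  \<open>J (x - y)\<close> over \<open>y\<close> uniform in \<open>x\<close>.\<close>

lemma
  fixes f :: "'a::euclidean_space \<Rightarrow> real" and x :: 'a
  assumes "integrable lborel f"
  shows integrable_reflect_lborel: "integrable lborel (\<lambda>y. f (x - y))"
    and integral_reflect_lborel: "(LINT y|lborel. f (x - y)) = (LINT y|lborel. f y)"
proof -
  have "integrable (distr lborel borel (\<lambda>y. x - y)) f"
    using assms by (simp add: lborel_distr_reflect)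
  then show "integrable lborel (\<lambda>y. f (x - y))"
    by (subst (asm) integrable_distr_eq) (use assms in auto)
  have "(LINT y|distr lborel borel (\<lambda>y. x - y). f y) = (LINT y|lborel. f (x - y))"
    by (subst integral_distr) (use assms in auto)
  then show "(LINT y|lborel. f (x - y)) = (LINT y|lborel. f y)"
    by (simp add: lborel_distr_reflect)
qed

text \<open>Since reflections preserve null sets, \<open>J (x - y)\<close> may be replaced by a
  Borel version under the integral over \<open>y\<close> for every single \<open>x\<close>, not just
  for almost every one.\<close>

lemma AE_lborel_reflect:
  fixes x :: "'a::euclidean_space"
  assumes "AE y in lborel. P y"
  shows "AE y in lborel. P (x - y)"
proof (rule AE_distrD[where M = lborel and M' = borel and f = "\<lambda>y. x - y"])
  show "(\<lambda>y. x - y) \<in> lborel \<rightarrow>\<^sub>M borel" by simp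
  show "AE y in distr lborel borel (\<lambda>y. x - y). P y"
    using assms by (simp only: lborel_distr_reflect)
qed

text \<open>Completeness of \<open>lebesgue\<close> makes \<open>f\<close> measurable as soon as it
  agrees almost everywhere with the Borel function \<open>g\<close>. If \<open>g\<close> is not
  integrable, both sides are 0 by convention.\<close>

lemma integral_lebesgue_eq_lborel_AE:
  fixes f g :: "'a::euclidean_space \<Rightarrow> real"
  assumes g: "g \<in> borel_measurable borel" and ae: "AE x in lborel. f x = g x"
  shows "integral\<^sup>L lebesgue f = integral\<^sup>L lborel g"
proof -
  have g': "g \<in> borel_measurable lebesgue"
    using g by (intro measurable_completion) simp
  have ae': "AE x in lebesgue. g x = f x"
    using ae by (intro AE_completion) auto
  have "integral\<^sup>L lebesgue f = integral\<^sup>L lebesgue g"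
    by (rule integral_cong_AE) (use g' ae' borel_measurable_AE[OF g' ae'] in auto)
  also have "\<dots> = integral\<^sup>L lborel g"
    using g by (intro integral_completion) simp
  finally show ?thesis .
qed

section \<open>Integrals over time intervals: barrier and weighted estimate\<close>

lemma bounded_set_integrable_Icc:
  fixes h :: "real \<Rightarrow> real"
  assumes "h \<in> borel_measurable borel" and "\<And>s. \<bar>h s\<bar> \<le> B"
  shows "set_integrable lborel {a..b} h"
  unfolding set_integrable_def
proof (rule Bochner_Integration.integrable_bound)
  show "integrable lborel (\<lambda>s. indicator {a..b} s * B)"
    by (intro integrable_mult_left integrable_real_indicator) (auto simp: emeasure_lborel_Icc_eq)
  show "(\<lambda>s. indicator {a..b} s *\<^sub>R h s) \<in> borel_measurable lborel"
    using assms(1) by simp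
  show "AE s in lborel. norm (indicator {a..b} s *\<^sub>R h s) \<le> norm (indicator {a..b} s * B)"
    using assms(2) by (auto simp: indicator_def intro!: AE_I2) (smt (verit) assms(2))
qed

lemma set_integral_Icc_split:
  fixes h :: "real \<Rightarrow> real"
  assumes "h \<in> borel_measurable borel" and "\<And>s. \<bar>h s\<bar> \<le> B" and "a \<le> b" "b \<le> c"
  shows "(LINT s:{a..c}|lborel. h s) = (LINT s:{a..b}|lborel. h s) + (LINT s:{b..c}|lborel. h s)"
proof -
  have "{a..c} = {a..b} \<union> {b..c}" using assms by auto
  moreover have "AE s in lborel. \<not> (s \<in> {a..b} \<and> s \<in> {b..c})"
    using AE_lborel_singleton[of b] by eventually_elim auto
  ultimately show ?thesis
    using bounded_set_integrable_Icc[OF assms(1,2)] 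
    by (simp add: set_integral_Un_AE)
qed

lemma set_integral_Icc_bound:
  fixes h :: "real \<Rightarrow> real"
  assumes "h \<in> borel_measurable borel" and "\<And>s. \<bar>h s\<bar> \<le> B" and "a \<le> b"
  shows "\<bar>LINT s:{a..b}|lborel. h s\<bar> \<le> B * (b - a)"
proof -
  have "\<bar>LINT s:{a..b}|lborel. h s\<bar> \<le> (LINT s:{a..b}|lborel. B)"
    unfolding set_lebesgue_integral_def real_norm_def[symmetric]
  proof (rule Bochner_Integration.integral_norm_bound_integral)
    show "integrable lborel (\<lambda>s. indicator {a..b} s *\<^sub>R h s)"
      using bounded_set_integrable_Icc[OF assms(1,2)] by (simp add: set_integrable_def)
    show "integrable lborel (\<lambda>s. indicator {a..b} s *\<^sub>R B)"
      by (intro integrable_scaleR_left integrable_real_indicator) (auto simp: emeasure_lborel_Icc_eq)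
    show "norm (indicator {a..b} s *\<^sub>R h s) \<le> indicator {a..b} s *\<^sub>R B" for s
      using assms(2)[of s] by (simp add: indicator_def)
  qed
  also have "\<dots> = B * (b - a)"
    using assms(3) by (simp add: set_lebesgue_integral_def)
  finally show ?thesis .
qed

text \<open>If \<phi> exceeded \<open>M\<close> at time \<open>t\<close>, there would be a last time
  \<open>r\<close> in \<open>[0, t]\<close> with \<open>\<phi> r \<le> M\<close>. After
  \<open>r\<close> the integrand is nonpositive by \<open>inward\<close>, so \<phi> cannot have
  grown from \<open>r\<close> to \<open>t\<close>.\<close>

lemma integral_equation_upper_barrier:
  fixes h \<phi> :: "real \<Rightarrow> real"
  assumes h: "h \<in> borel_measurable borel" and B: "\<And>s. \<bar>h s\<bar> \<le> B"
    and \<phi>: "\<And>t. 0 \<le> t \<Longrightarrow> \<phi> t = c + (LINT s:{0..t}|lborel. h s)"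
    and inward: "\<And>s. 0 \<le> s \<Longrightarrow> M \<le> \<phi> s \<Longrightarrow> h s \<le> 0"
    and "c \<le> M" and "0 \<le> t"
  shows "\<phi> t \<le> M"
proof (rule ccontr)
  assume "\<not> \<phi> t \<le> M"
  have incr: "\<phi> b - \<phi> a = (LINT s:{a..b}|lborel. h s)" if "0 \<le> a" "a \<le> b" for a b
    using \<phi>[of a] \<phi>[of b] set_integral_Icc_split[OF h B, of 0 a b] that by simp
  have "B \<ge> 0" using B[of 0] by simp
  have lip: "\<bar>\<phi> b - \<phi> a\<bar> \<le> B * \<bar>b - a\<bar>" if "0 \<le> a" "0 \<le> b" for a b
    using set_integral_Icc_bound[OF h B, of a b] set_integral_Icc_bound[OF h B, of b a]
      incr[of a b] incr[of b a] that by (cases "a \<le> b") auto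
  have cont: "continuous_on {0..t} \<phi>"
    by (rule lipschitz_on_continuous_on[where L = B])
      (use lip \<open>B \<ge> 0\<close> in \<open>auto intro!: lipschitz_onI simp: dist_real_def abs_minus_commute\<close>)
  define S where "S = {s \<in> {0..t}. \<phi> s \<le> M}"
  \<comment> \<open>Boundedness of \<open>h\<close> makes \<phi> Lipschitz; closedness of
    \<open>S\<close> follows, and with it the existence of the last time.\<close>
  have "compact S" unfolding S_def
    using continuous_closed_preimage[OF cont, of "{..M}"]
    by (auto simp: compact_eq_bounded_closed vimage_def Int_def conj_commute intro: bounded_subset[of "{0..t}"])
  moreover have "\<phi> 0 \<le> M"
    using \<phi>[of 0] set_integral_Icc_bound[OF h B, of 0 0] \<open>c \<le> M\<close> by simp
  then have "0 \<in> S" using \<open>0 \<le> t\<close> by (simp add: S_def)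
  ultimately obtain r where r: "r \<in> S" "\<And>s. s \<in> S \<Longrightarrow> s \<le> r"
    using compact_attains_sup[of S] by auto
  have "(LINT s:{r..t}|lborel. h s) \<le> (LINT (s::real)|lborel. 0)"
    unfolding set_lebesgue_integral_def
  proof (rule integral_mono_AE')
    show "AE s in lborel. indicator {r..t} s *\<^sub>R h s \<le> 0"
      \<comment> \<open>The time \<open>r\<close> itself lies in \<open>S\<close>, where the sign of
        \<open>h\<close> may be unknown; it is discarded as a null set.\<close>
      using AE_lborel_singleton[of r]
    proof eventually_elim
      case (elim s)
      show ?case
      proof (cases "s \<in> {r..t}")
        case True
        then have "s \<notin> S" using r(2)[of s] elim by auto
        then show ?thesis using True r(1) inward[of s] by (auto simp: S_def)
      qed simp
    qed
  qed simp_all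
  then have "\<phi> t \<le> \<phi> r" using incr[of r t] r(1) by (simp add: S_def)
  then show False using r(1) \<open>\<not> \<phi> t \<le> M\<close> by (simp add: S_def)
qed

text \<open>The weight grows at twice the Lipschitz rate: an antiderivative of
  \<open>L * exp (2 * L * s)\<close> is \<open>exp (2 * L * s) / 2\<close>, which is the source of
  the contraction factor 1/2.\<close>

lemma set_integral_exp_weight:
  fixes f g :: "real \<Rightarrow> real"
  assumes f: "f \<in> borel_measurable borel" "\<And>s. \<bar>f s\<bar> \<le> B"
    and g: "g \<in> borel_measurable borel" "\<And>s. \<bar>g s\<bar> \<le> B"
    and "0 < L" "0 \<le> A" "0 \<le> t"
    and le: "AE s in lborel. s \<in> {0..t} \<longrightarrow> \<bar>f s - g s\<bar> \<le> L * (A * exp (2 * L * s))"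
  shows "\<bar>(LINT s:{0..t}|lborel. f s) - (LINT s:{0..t}|lborel. g s)\<bar> \<le> A / 2 * exp (2 * L * t)"
proof -
  have "has_bochner_integral lborel (\<lambda>s. L * A * exp (2 * L * s) * indicator {0..t} s)
      (A / 2 * exp (2 * L * t) - A / 2 * exp (2 * L * 0))"
    by (rule has_bochner_integral_FTC_Icc_real)
      (use assms(5,7) in \<open>auto intro!: derivative_eq_intros continuous_intros\<close>)
  then have FTC: "integrable lborel (\<lambda>s. L * A * exp (2 * L * s) * indicator {0..t} s)"
    "(LINT s|lborel. L * A * exp (2 * L * s) * indicator {0..t} s)
       = A / 2 * exp (2 * L * t) - A / 2 * exp (2 * L * 0)"
    by (auto simp: has_bochner_integral_iff)
  have i: "set_integrable lborel {0..t} f" "set_integrable lborel {0..t} g"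
    using bounded_set_integrable_Icc f g by blast+
  have "\<bar>(LINT s:{0..t}|lborel. f s) - (LINT s:{0..t}|lborel. g s)\<bar>
      = \<bar>LINT s:{0..t}|lborel. f s - g s\<bar>"
    using i by (simp add: set_integral_diff)
  also have "\<dots> \<le> (LINT s|lborel. \<bar>indicator {0..t} s *\<^sub>R (f s - g s)\<bar>)"
    unfolding set_lebesgue_integral_def by (rule integral_abs_bound)
  also have "\<dots> \<le> (LINT s|lborel. L * A * exp (2 * L * s) * indicator {0..t} s)"
  proof (rule integral_mono_AE'[OF FTC(1)])
    show "AE s in lborel. \<bar>indicator {0..t} s *\<^sub>R (f s - g s)\<bar>
        \<le> L * A * exp (2 * L * s) * indicator {0..t} s"
      using le by eventually_elim (auto simp: indicator_def ac_simps)
  qed (use assms(5,6) in auto)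
  also have "\<dots> \<le> A / 2 * exp (2 * L * t)"
    using FTC(2) \<open>0 \<le> A\<close> by simp
  finally show ?thesis .
qed

section \<open>Picard iteration for a bounded Lipschitz nonlinearity\<close>

text \<open>\<open>F a b\<close> stands for the clipped form of \<open>k a b * (b - a)\<close>.
  Treating the product as one function leaves a Lipschitz constant and a bound as the only facts
  about \<open>k\<close> that the iteration uses.\<close>

locale nonlocal_kernel =
  fixes F :: "real \<Rightarrow> real \<Rightarrow> real" and J :: "'a::euclidean_space \<Rightarrow> real" and l C :: real
  assumes F_lipschitz: "\<And>a b a' b'. \<bar>F a b - F a' b'\<bar> \<le> l * (\<bar>a - a'\<bar> + \<bar>b - b'\<bar>)"
    and F_bounded: "\<And>a b. \<bar>F a b\<bar> \<le> C"
    and J_nonneg: "\<And>z. 0 \<le> J z"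
    and J_borel [measurable]: "J \<in> borel_measurable borel"
    and J_integrable: "integrable lborel J"
begin

definition G :: "('a \<Rightarrow> real) \<Rightarrow> 'a \<Rightarrow> real" where
  "G w x = (LINT y|lborel. F (w x) (w y) * J (x - y))"

definition mass :: real where
  "mass = (LINT y|lborel. J y)"

text \<open>The summand 1 makes the rate positive and lets \<open>exp (2 * L * t)\<close> dominate \<open>t\<close>.\<close>

definition L :: real where
  "L = 2 * l * mass + 1"

text \<open>Off \<open>S\<close> the value is frozen at \<open>U x\<close>, which encodes the
  exterior condition because the initial datum equals \<psi> there. Time and space form one argument
  so that joint measurability can be stated and passed to limits.\<close>

definition picard :: "('a \<Rightarrow> real) \<Rightarrow> 'a set \<Rightarrow> (real \<times> 'a \<Rightarrow> real) \<Rightarrow> real \<times> 'a \<Rightarrow> real" where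
  "picard U S w = (\<lambda>(t, x). U x +
     (if x \<in> S then LINT s:{0..t}|lborel. G (\<lambda>y. w (s, y)) x else 0))"

lemma l_nonneg: "0 \<le> l"
  using F_lipschitz[of 0 0 1 0] by simp

lemma C_nonneg: "0 \<le> C"
  using F_bounded[of 0 0] by simp

lemma mass_nonneg: "0 \<le> mass"
  unfolding mass_def by (intro integral_nonneg_AE AE_I2 J_nonneg)

lemma L_ge_1: "1 \<le> L"
  using l_nonneg mass_nonneg by (simp add: L_def)

lemma integrable_J_reflect: "integrable lborel (\<lambda>y. J (x - y))"
  using J_integrable by (rule integrable_reflect_lborel)

lemma integral_J_reflect: "(LINT y|lborel. J (x - y)) = mass"
  unfolding mass_def using J_integrable by (rule integral_reflect_lborel)

lemma F_measurable: "(\<lambda>p. F (fst p) (snd p)) \<in> borel_measurable (borel \<Otimes>\<^sub>M borel)"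
proof -
  have "continuous_on UNIV (\<lambda>p. F (fst p) (snd p))"
  proof (rule lipschitz_on_continuous_on[where L = "2 * l"], rule lipschitz_onI)
    fix p q :: "real \<times> real"
    have "\<bar>fst p - fst q\<bar> \<le> dist p q" "\<bar>snd p - snd q\<bar> \<le> dist p q"
      using dist_fst_le[of p q] dist_snd_le[of p q] by (simp_all add: dist_real_def)
    then have "l * (\<bar>fst p - fst q\<bar> + \<bar>snd p - snd q\<bar>) \<le> l * (2 * dist p q)"
      using l_nonneg by (intro mult_left_mono) auto
    then show "dist (F (fst p) (snd p)) (F (fst q) (snd q)) \<le> 2 * l * dist p q"
      using F_lipschitz[of "fst p" "snd p" "fst q" "snd q"] by (simp add: dist_real_def)
  qed (use l_nonneg in simp)
  then show ?thesis
    by (simp add: borel_measurable_continuous_onI borel_prod)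
qed

lemma F_measurable_compose [measurable (raw)]:
  assumes "f \<in> borel_measurable M" "g \<in> borel_measurable M"
  shows "(\<lambda>x. F (f x) (g x)) \<in> borel_measurable M"
  using measurable_compose[OF measurable_Pair[OF assms] F_measurable] by simp

lemma integrable_G:
  assumes [measurable]: "w \<in> borel_measurable borel"
  shows "integrable lborel (\<lambda>y. F (w x) (w y) * J (x - y))"
proof (rule Bochner_Integration.integrable_bound)
  show "integrable lborel (\<lambda>y. C * J (x - y))"
    using integrable_J_reflect by simp
  show "AE y in lborel. norm (F (w x) (w y) * J (x - y)) \<le> norm (C * J (x - y))"
    using F_bounded C_nonneg J_nonneg by (auto simp: abs_mult intro!: mult_right_mono)
qed simp

lemma G_bounded: "\<bar>G w x\<bar> \<le> C * mass"
proof -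
  have "\<bar>G w x\<bar> \<le> (LINT y|lborel. \<bar>F (w x) (w y) * J (x - y)\<bar>)"
    unfolding G_def by (rule integral_abs_bound)
  also have "\<dots> \<le> (LINT y|lborel. C * J (x - y))"
    using F_bounded C_nonneg J_nonneg integrable_J_reflect
    by (intro integral_mono_AE') (auto simp: abs_mult intro!: mult_right_mono)
  finally show ?thesis
    by (simp add: integral_J_reflect)
qed

text \<open>The value at \<open>x\<close> enters the integrand for all \<open>y\<close>, and a bound
  for almost every \<open>y\<close> says nothing about the single point \<open>x\<close>; hence the
  separate hypothesis at \<open>x\<close>. Each of the two arguments of \<open>F\<close> contributes
  \<open>l * A\<close>.\<close>

lemma G_diff:
  assumes "w \<in> borel_measurable borel" "z \<in> borel_measurable borel"
    and x: "\<bar>w x - z x\<bar> \<le> A" and y: "AE y in lborel. \<bar>w y - z y\<bar> \<le> A"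
  shows "\<bar>G w x - G z x\<bar> \<le> L * A"
proof -
  have "0 \<le> A" using x by simp
  have "\<bar>G w x - G z x\<bar> = \<bar>LINT y|lborel. F (w x) (w y) * J (x - y) - F (z x) (z y) * J (x - y)\<bar>"
    unfolding G_def using assms(1,2) by (simp add: integrable_G Bochner_Integration.integral_diff)
  also have "\<dots> \<le> (LINT y|lborel. \<bar>F (w x) (w y) * J (x - y) - F (z x) (z y) * J (x - y)\<bar>)"
    by (rule integral_abs_bound)
  also have "\<dots> \<le> (LINT y|lborel. (2 * l * A) * J (x - y))"
  proof (rule integral_mono_AE')
    show "integrable lborel (\<lambda>y. (2 * l * A) * J (x - y))"
      using integrable_J_reflect by simp
    show "AE y in lborel. \<bar>F (w x) (w y) * J (x - y) - F (z x) (z y) * J (x - y)\<bar>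
        \<le> 2 * l * A * J (x - y)"
      using y
    proof eventually_elim
      case (elim y)
      have "\<bar>F (w x) (w y) - F (z x) (z y)\<bar> \<le> l * (\<bar>w x - z x\<bar> + \<bar>w y - z y\<bar>)"
        by (rule F_lipschitz)
      also have "\<dots> \<le> l * (A + A)"
        using elim x l_nonneg by (intro mult_left_mono add_mono)
      finally have "\<bar>F (w x) (w y) - F (z x) (z y)\<bar> * J (x - y) \<le> 2 * l * A * J (x - y)"
        using J_nonneg by (intro mult_right_mono) auto
      then show ?case
        using J_nonneg[of "x - y"] by (simp add: abs_mult flip: left_diff_distrib)
    qed
  qed (use l_nonneg J_nonneg \<open>0 \<le> A\<close> in auto)
  also have "\<dots> = 2 * l * mass * A"
    by (simp add: integral_J_reflect)
  also have "\<dots> \<le> L * A"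
    using \<open>0 \<le> A\<close> by (simp add: L_def distrib_right)
  finally show ?thesis .
qed

lemma G_measurable [measurable]:
  assumes [measurable]: "w \<in> borel_measurable (borel \<Otimes>\<^sub>M borel)"
  shows "(\<lambda>p. G (\<lambda>y. w (fst p, y)) (snd p)) \<in> borel_measurable (borel \<Otimes>\<^sub>M borel)"
  unfolding G_def by measurable

lemma G_measurable_time [measurable]:
  assumes "w \<in> borel_measurable (borel \<Otimes>\<^sub>M borel)"
  shows "(\<lambda>s. G (\<lambda>y. w (s, y)) x) \<in> borel_measurable borel"
  using measurable_compose[OF _ G_measurable[OF assms], of "\<lambda>s. (s, x)" borel] by simp

lemma picard_measurable [measurable]:
  assumes [measurable]: "U \<in> borel_measurable borel" "S \<in> sets borel"
    "w \<in> borel_measurable (borel \<Otimes>\<^sub>M borel)"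
  shows "picard U S w \<in> borel_measurable (borel \<Otimes>\<^sub>M borel)"
proof -
  have [measurable]: "(\<lambda>(p, s). G (\<lambda>y. w (s, y)) (snd p)) 
      \<in> borel_measurable ((borel \<Otimes>\<^sub>M borel) \<Otimes>\<^sub>M borel)"
    using measurable_compose[OF _ G_measurable[OF assms(3)],
        of "\<lambda>q. (snd q, snd (fst q))" "(borel \<Otimes>\<^sub>M borel) \<Otimes>\<^sub>M borel"]
    by (simp add: case_prod_beta')
  \<comment> \<open>The domain \<open>{0..t}\<close> depends on the parameter. Written as a
    condition inside an integral over the whole line, it becomes part of a jointly measurable
    integrand.\<close>
  have "(\<lambda>p. U (snd p) + (if snd p \<in> S then
      LINT s|lborel. (if 0 \<le> s \<and> s \<le> fst p then G (\<lambda>y. w (s, y)) (snd p) else 0) else 0))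
      \<in> borel_measurable (borel \<Otimes>\<^sub>M borel)"
    by measurable
  also have "(\<lambda>p. U (snd p) + (if snd p \<in> S then
      LINT s|lborel. (if 0 \<le> s \<and> s \<le> fst p then G (\<lambda>y. w (s, y)) (snd p) else 0) else 0))
      = picard U S w"
    by (auto simp: fun_eq_iff picard_def set_lebesgue_integral_def indicator_def
        intro!: Bochner_Integration.integral_cong)
  finally show ?thesis .
qed

text \<open>Everything here holds at every point, which suits the construction of a solution from
  Borel data: no null sets have to be carried through the iteration.\<close>

lemma picard_contraction:
  assumes [measurable]: "w \<in> borel_measurable (borel \<Otimes>\<^sub>M borel)"
      "z \<in> borel_measurable (borel \<Otimes>\<^sub>M borel)"
    and "0 \<le> A" and le: "\<And>t x. 0 \<le> t \<Longrightarrow> \<bar>w (t, x) - z (t, x)\<bar> \<le> A * exp (2 * L * t)"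
    and "0 \<le> t"
  shows "\<bar>picard U S w (t, x) - picard U S z (t, x)\<bar> \<le> A / 2 * exp (2 * L * t)"
proof (cases "x \<in> S")
  case True
  have "\<bar>(LINT s:{0..t}|lborel. G (\<lambda>y. w (s, y)) x) - (LINT s:{0..t}|lborel. G (\<lambda>y. z (s, y)) x)\<bar>
      \<le> A / 2 * exp (2 * L * t)"
  proof (rule set_integral_exp_weight)
    show "AE s in lborel. s \<in> {0..t} \<longrightarrow>
        \<bar>G (\<lambda>y. w (s, y)) x - G (\<lambda>y. z (s, y)) x\<bar> \<le> L * (A * exp (2 * L * s))"
      using le by (intro AE_I2 impI G_diff) auto
  qed (use G_bounded L_ge_1 assms in auto)
  then show ?thesis using True by (simp add: picard_def)
next
  case False
  then show ?thesis using \<open>0 \<le> A\<close> by (simp add: picard_def)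
qed

text \<open>The iterates form a geometric Cauchy sequence at each point. Taking pointwise limits,
  rather than limits in a space of equivalence classes, keeps the fixed point jointly Borel and the
  equation valid everywhere.\<close>

theorem picard_fixpoint:
  assumes [measurable]: "U \<in> borel_measurable borel" "S \<in> sets borel"
  obtains u where "u \<in> borel_measurable (borel \<Otimes>\<^sub>M borel)"
    and "\<And>t x. 0 \<le> t \<Longrightarrow> u (t, x) = picard U S u (t, x)"
proof -
  define w where "w n = (picard U S ^^ n) (\<lambda>p. U (snd p))" for n
  have w_Suc: "w (Suc n) = picard U S (w n)" for n
    by (simp add: w_def)
  have w_meas [measurable]: "w n \<in> borel_measurable (borel \<Otimes>\<^sub>M borel)" for n
    by (induction n) (simp_all add: w_Suc, simp add: w_def)
  \<comment> \<open>This constant bounds \<open>G\<close>, so the first iteration step is at most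
    \<open>A * t\<close>, which lies below \<open>A * exp (2 * L * t)\<close> because
    \<open>L\<close> is at least 1.\<close>
  define A where "A = C * mass"
  have "0 \<le> A" using C_nonneg mass_nonneg by (simp add: A_def)
  define E where "E t = A * exp (2 * L * t)" for t
  have step: "\<bar>w (Suc n) (t, x) - w n (t, x)\<bar> \<le> E t / 2 ^ n" if "0 \<le> t" for n t x
    using that
  proof (induction n arbitrary: t x)
    case 0
    have "\<bar>LINT s:{0..t}|lborel. G (\<lambda>y. w 0 (s, y)) x\<bar> \<le> A * (t - 0)"
      unfolding A_def using 0 G_bounded by (intro set_integral_Icc_bound) auto
    also have "t \<le> L * t"
      using mult_right_mono[OF L_ge_1 0] by simp
    then have "t \<le> exp (2 * L * t)"
      using exp_ge_add_one_self[of "2 * L * t"] 0 by linarith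
    then have "A * (t - 0) \<le> E t"
      unfolding E_def using \<open>0 \<le> A\<close> by (intro mult_left_mono) auto
    finally show ?case
      using \<open>0 \<le> A\<close> by (simp add: w_Suc picard_def) (simp add: w_def E_def)
  next
    case (Suc n)
    have "\<bar>picard U S (w (Suc n)) (t, x) - picard U S (w n) (t, x)\<bar>
        \<le> (A / 2 ^ n) / 2 * exp (2 * L * t)"
      using Suc \<open>0 \<le> A\<close> by (intro picard_contraction) (auto simp: E_def)
    then show ?case by (simp add: w_Suc E_def field_simps)
  qed
  have dist: "\<bar>w (n + m) (t, x) - w n (t, x)\<bar> \<le> 2 * E t / 2 ^ n" if "0 \<le> t" for n m t x
  proof -
    \<comment> \<open>The subtracted term is the remainder of the geometric series; keeping it makes
      the induction on \<open>m\<close> close.\<close>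
    have "\<bar>w (n + m) (t, x) - w n (t, x)\<bar> \<le> 2 * E t / 2 ^ n - 2 * E t / 2 ^ (n + m)"
    proof (induction m)
      case (Suc m)
      have "2 * E t / 2 ^ (n + m) - E t / 2 ^ (n + m) = 2 * E t / 2 ^ (n + Suc m)"
        by simp
      then show ?case
        using Suc step[OF that, of "n + m" x] by (simp del: power_Suc)
    qed simp
    also have "\<dots> \<le> 2 * E t / 2 ^ n"
      using \<open>0 \<le> A\<close> by (simp add: E_def)
    finally show ?thesis .
  qed
  have E_lim: "(\<lambda>n. c * E t / 2 ^ n) \<longlonglongrightarrow> 0" for c t
    by (rule LIMSEQ_divide_realpow_zero) simp
  have "convergent (\<lambda>n. w n (t, x))" if "0 \<le> t" for t x
  proof (rule Cauchy_convergent, rule metric_CauchyI)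
    fix e :: real assume "0 < e"
    then obtain N where N: "\<And>n. n \<ge> N \<Longrightarrow> norm (4 * E t / 2 ^ n - 0) < e"
      using LIMSEQ_D[OF E_lim, of e 4 t] by auto
    have "dist (w m (t, x)) (w n (t, x)) < e" if "N \<le> m" "N \<le> n" for m n
    proof -
      have "dist (w m (t, x)) (w n (t, x)) \<le> 2 * E t / 2 ^ N + 2 * E t / 2 ^ N"
        using dist[OF \<open>0 \<le> t\<close>, of N "m - N" x] dist[OF \<open>0 \<le> t\<close>, of N "n - N" x] that
        unfolding dist_real_def by auto
      also have "\<dots> = 4 * E t / 2 ^ N" by simp
      also have "\<dots> < e" using N[OF order_refl] unfolding real_norm_def by linarith
      finally show ?thesis .
    qed
    then show "\<exists>N. \<forall>m\<ge>N. \<forall>n\<ge>N. dist (w m (t, x)) (w n (t, x)) < e" by blast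
  qed
  then have conv: "(\<lambda>n. w n (t, x)) \<longlonglongrightarrow> lim (\<lambda>n. w n (t, x))" if "0 \<le> t" for t x
    using that by (simp add: convergent_LIMSEQ_iff)
  define u where "u p = lim (\<lambda>n. w n p)" for p
  have u_meas [measurable]: "u \<in> borel_measurable (borel \<Otimes>\<^sub>M borel)"
    unfolding u_def by measurable
  have tail: "\<bar>u (t, x) - w n (t, x)\<bar> \<le> 2 * E t / 2 ^ n" if "0 \<le> t" for t x n
  proof (rule LIMSEQ_le_const2)
    show "(\<lambda>m. \<bar>w (n + m) (t, x) - w n (t, x)\<bar>) \<longlonglongrightarrow> \<bar>u (t, x) - w n (t, x)\<bar>"
      unfolding u_def using LIMSEQ_ignore_initial_segment[OF conv[OF that, of x], of n]
      by (intro tendsto_intros) (simp add: add.commute)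
  qed (use dist[OF that] in auto)
  have "u (t, x) = picard U S u (t, x)" if "0 \<le> t" for t x
  proof (rule LIMSEQ_unique)
    show "(\<lambda>n. w (Suc n) (t, x)) \<longlonglongrightarrow> u (t, x)"
      unfolding u_def using conv[OF that] by (rule LIMSEQ_Suc)
    \<comment> \<open>The contraction halves the tail bound \<open>2 * E t / 2 ^ n\<close>, so the
      iterates also converge to \<open>picard U S u\<close>.\<close>
    have "\<bar>picard U S u (t, x) - w (Suc n) (t, x)\<bar> \<le> 1 * E t / 2 ^ n" for n
      using picard_contraction[of u "w n" "2 * A / 2 ^ n" t U S x] tail[of _ _ n] that \<open>0 \<le> A\<close>
      by (simp add: w_Suc E_def field_simps)
    then have "(\<lambda>n. picard U S u (t, x) - w (Suc n) (t, x)) \<longlonglongrightarrow> 0"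
      by (intro Lim_null_comparison[OF _ E_lim[of 1 t]]) auto
    then have "(\<lambda>n. picard U S u (t, x) - (picard U S u (t, x) - w (Suc n) (t, x)))
        \<longlonglongrightarrow> picard U S u (t, x) - 0"
      by (intro tendsto_intros)
    then show "(\<lambda>n. w (Suc n) (t, x)) \<longlonglongrightarrow> picard U S u (t, x)" by simp
  qed
  with u_meas show ?thesis by (rule that)
qed

end

text \<open>Fubini turns "for almost every \<open>s\<close>, almost every \<open>x\<close>" into the
  reverse order. For a fixed good \<open>x\<close> the time integral can then be estimated for all
  \<open>t\<close> at once, so the exceptional set of \<open>x\<close> does not depend on
  \<open>t\<close>.\<close>

lemma (in nonlocal_kernel) picard_contraction_AE:
  assumes [measurable]: "w \<in> borel_measurable (borel \<Otimes>\<^sub>M borel)"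
      "z \<in> borel_measurable (borel \<Otimes>\<^sub>M borel)"
    and "0 \<le> A"
    and le: "AE s in lborel. s \<in> {0..T} \<longrightarrow>
      (AE x in lborel. \<bar>w (s, x) - z (s, x)\<bar> \<le> A * exp (2 * L * s))"
  shows "AE x in lborel. \<forall>t\<in>{0..T}.
    \<bar>picard U S w (t, x) - picard U S z (t, x)\<bar> \<le> A / 2 * exp (2 * L * t)"
proof -
  have "AE s in lborel. AE x in lborel. s \<in> {0..T} \<longrightarrow>
      \<bar>G (\<lambda>y. w (s, y)) x - G (\<lambda>y. z (s, y)) x\<bar> \<le> L * (A * exp (2 * L * s))"
    using le
  proof eventually_elim
    case (elim s)
    show ?case
    proof (cases "s \<in> {0..T}")
      case True
      with elim have ae: "AE x in lborel. \<bar>w (s, x) - z (s, x)\<bar> \<le> A * exp (2 * L * s)" by blast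
      from ae show ?thesis
      proof eventually_elim
        case (elim x)
        then show ?case using ae by (intro impI G_diff) auto
      qed
    next
      case False
      then show ?thesis by (intro AE_I2) blast
    qed
  qed
  moreover have "{p \<in> space (lborel \<Otimes>\<^sub>M lborel). fst p \<in> {0..T} \<longrightarrow>
      \<bar>G (\<lambda>y. w (fst p, y)) (snd p) - G (\<lambda>y. z (fst p, y)) (snd p)\<bar>
        \<le> L * (A * exp (2 * L * fst p))} \<in> sets (lborel \<Otimes>\<^sub>M lborel)"
    by measurable
  ultimately have "AE x in lborel. AE s in lborel. s \<in> {0..T} \<longrightarrow>
      \<bar>G (\<lambda>y. w (s, y)) x - G (\<lambda>y. z (s, y)) x\<bar> \<le> L * (A * exp (2 * L * s))"
    by (subst (asm) lborel_pair.AE_commute)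
  then show ?thesis
  proof eventually_elim
    case (elim x)
    show ?case
    proof
      fix t assume t: "t \<in> {0..T}"
      have "\<bar>(LINT s:{0..t}|lborel. G (\<lambda>y. w (s, y)) x) - (LINT s:{0..t}|lborel. G (\<lambda>y. z (s, y)) x)\<bar>
          \<le> A / 2 * exp (2 * L * t)"
      proof (rule set_integral_exp_weight)
        show "AE s in lborel. s \<in> {0..t} \<longrightarrow>
            \<bar>G (\<lambda>y. w (s, y)) x - G (\<lambda>y. z (s, y)) x\<bar> \<le> L * (A * exp (2 * L * s))"
          using elim by eventually_elim (use t in auto)
      qed (use G_bounded L_ge_1 assms t in auto)
      then show "\<bar>picard U S w (t, x) - picard U S z (t, x)\<bar> \<le> A / 2 * exp (2 * L * t)"
        using \<open>0 \<le> A\<close> by (auto simp: picard_def)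
    qed
  qed
qed

section \<open>Clipping and essentially bounded functions\<close>

definition clip :: "real \<Rightarrow> real \<Rightarrow> real" where
  "clip R a = max (- R) (min R a)"

lemma clip_measurable [measurable]: "clip R \<in> borel_measurable borel"
  unfolding clip_def by measurable

lemma abs_clip_le: "0 \<le> R \<Longrightarrow> \<bar>clip R a\<bar> \<le> R"
  by (auto simp: clip_def)

lemma clip_id: "\<bar>a\<bar> \<le> R \<Longrightarrow> clip R a = a"
  by (auto simp: clip_def)

lemma clip_nonexpansive: "\<bar>clip R a - clip R b\<bar> \<le> \<bar>a - b\<bar>"
  by (auto simp: clip_def)

lemma Linf_norm_le:
  assumes "f \<in> borel_measurable M" and "AE x in M. \<bar>f x\<bar> \<le> c"
  shows "Linf_norm M f \<le> ereal c"
  unfolding Linf_norm_def using assms by (intro esssup_I) auto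

lemma AE_Linf_norm: "AE x in M. ereal \<bar>f x\<bar> \<le> Linf_norm M f"
  unfolding Linf_norm_def by (rule esssup_AE)

text \<open>On a space of measure zero the essential supremum is minus infinity, so the positive
  mass of \<open>lebesgue\<close> matters. A nonmeasurable argument has essential supremum
  infinity.\<close>

lemma Linf_norm_lebesgue_nonneg: "0 \<le> Linf_norm lebesgue (f :: 'a::euclidean_space \<Rightarrow> real)"
proof (cases "(\<lambda>x. ereal \<bar>f x\<bar>) \<in> borel_measurable lebesgue")
  case True
  have "esssup lebesgue (\<lambda>x::'a. 0::ereal) = 0"
    by (intro esssup_const) simp
  then show ?thesis
    using esssup_mono[of "\<lambda>x::'a. 0::ereal" lebesgue "\<lambda>x. ereal \<bar>f x\<bar>"]
    by (simp add: Linf_norm_def)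
qed (simp add: Linf_norm_def esssup_non_measurable)

lemma Linf_AE_bounded:
  assumes "f \<in> Linf M"
  obtains c where "0 \<le> c" "AE x in M. \<bar>f x\<bar> \<le> c"
proof (cases "Linf_norm M f")
  case (real r)
  have "AE x in M. \<bar>f x\<bar> \<le> max 0 r"
    using AE_Linf_norm[of f M] by eventually_elim (auto simp: real)
  then show ?thesis using that[of "max 0 r"] by simp
next
  case PInf
  then show ?thesis using assms by (simp add: Linf_def)
next
  \<comment> \<open>This can occur only if the measure is zero, and then every property holds almost
    everywhere.\<close>
  case MInf
  have "AE x in M. \<bar>f x\<bar> \<le> 0"
    using AE_Linf_norm[of f M] by eventually_elim (auto simp: MInf)
  then show ?thesis using that[of 0] by simp
qed

text \<open>Continuity in the norm bounds \<open>u\<close> near each time, and the bisection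
  principle \<open>Bolzano\<close> joins the local bounds into one on the compact interval.\<close>

lemma C_Linf_bounded_Icc:
  assumes u: "u \<in> C_Linf M" and "0 \<le> T"
  obtains R where "0 \<le> R" "\<And>t. t \<in> {0..T} \<Longrightarrow> AE x in M. \<bar>u t x\<bar> \<le> R"
proof -
  \<comment> \<open>The guard \<open>0 \<le> t\<close> is there because the small intervals in the
    local case of \<open>Bolzano\<close> may extend to negative times, where nothing is known about
    \<open>u\<close>.\<close>
  have "\<exists>R\<ge>0. \<forall>t\<in>{a..b}. 0 \<le> t \<longrightarrow> (AE x in M. \<bar>u t x\<bar> \<le> R)" if "0 \<le> a" "a \<le> b" for a b
    using \<open>a \<le> b\<close>
  proof (induction rule: Bolzano)
    case (trans a b c)
    from trans(1) obtain R1 where R1: "0 \<le> R1"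
      "\<forall>t\<in>{a..b}. 0 \<le> t \<longrightarrow> (AE x in M. \<bar>u t x\<bar> \<le> R1)"
      by (elim exE conjE)
    from trans(2) obtain R2 where R2: "0 \<le> R2"
      "\<forall>t\<in>{b..c}. 0 \<le> t \<longrightarrow> (AE x in M. \<bar>u t x\<bar> \<le> R2)"
      by (elim exE conjE)
    have "AE x in M. \<bar>u t x\<bar> \<le> max R1 R2" if t: "t \<in> {a..c}" "0 \<le> t" for t
    proof (cases "t \<le> b")
      case True
      then have "AE x in M. \<bar>u t x\<bar> \<le> R1" using R1(2) t by auto
      then show ?thesis by eventually_elim auto
    next
      case False
      then have "AE x in M. \<bar>u t x\<bar> \<le> R2" using R2(2) t by auto
      then show ?thesis by eventually_elim auto
    qed
    then have "\<forall>t\<in>{a..c}. 0 \<le> t \<longrightarrow> (AE x in M. \<bar>u t x\<bar> \<le> max R1 R2)"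
      by blast
    moreover have "0 \<le> max R1 R2" using R1(1) by simp
    ultimately show ?case by (intro exI[of _ "max R1 R2"] conjI)
  next
    case (local t)
    with \<open>0 \<le> a\<close> have "0 \<le> t" by simp
    then have "u t \<in> Linf M" using u by (simp add: C_Linf_def)
    then obtain c where c: "0 \<le> c" "AE x in M. \<bar>u t x\<bar> \<le> c" by (rule Linf_AE_bounded)
    have "((\<lambda>s. Linf_norm M (\<lambda>x. u s x - u t x)) \<longlongrightarrow> 0) (at t within {0..})"
      using u \<open>0 \<le> t\<close> by (simp add: C_Linf_def)
    then have "eventually (\<lambda>s. Linf_norm M (\<lambda>x. u s x - u t x) < 1) (at t within {0..})"
      by (rule order_tendstoD) simp
    then obtain d where d: "0 < d"
      "\<forall>s\<in>{0..}. s \<noteq> t \<and> dist s t < d \<longrightarrow> Linf_norm M (\<lambda>x. u s x - u t x) < 1"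
      unfolding eventually_at by (elim exE conjE)
    have "AE x in M. \<bar>u s x\<bar> \<le> c + 1" if "0 \<le> s" "dist s t < d" for s
    proof (cases "s = t")
      case True
      from c(2) show ?thesis by eventually_elim (use True in simp)
    next
      case False
      show ?thesis
        using AE_Linf_norm[of "\<lambda>x. u s x - u t x" M] c(2)
      proof eventually_elim
        case (elim x)
        have "ereal \<bar>u s x - u t x\<bar> < 1"
          using elim(1) d(2) that False by (intro le_less_trans[OF elim(1)]) simp
        then have "\<bar>u s x - u t x\<bar> < 1" by simp
        then show ?case using elim(2) by linarith
      qed
    qed
    then have near: "\<forall>s\<in>{a..b}. 0 \<le> s \<longrightarrow> (AE x in M. \<bar>u s x\<bar> \<le> c + 1)"
      if "a \<le> t \<and> t \<le> b \<and> b - a < d" for a b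
    proof (intro ballI impI)
      fix s assume "s \<in> {a..b}" "0 \<le> s"
      moreover from this have "dist s t < d" using that by (auto simp: dist_real_def)
      ultimately show "AE x in M. \<bar>u s x\<bar> \<le> c + 1"
        using \<open>\<And>s. 0 \<le> s \<Longrightarrow> dist s t < d \<Longrightarrow> AE x in M. \<bar>u s x\<bar> \<le> c + 1\<close> by blast
    qed
    have "0 \<le> c + 1" using c(1) by simp
    show ?case
    proof (rule exI[of _ d], intro conjI allI impI)
      show "\<exists>R\<ge>0. \<forall>s\<in>{a..b}. 0 \<le> s \<longrightarrow> (AE x in M. \<bar>u s x\<bar> \<le> R)"
        if "a \<le> t \<and> t \<le> b \<and> b - a < d" for a b
        using near[OF that] \<open>0 \<le> c + 1\<close> by (intro exI[of _ "c + 1"] conjI)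
    qed (rule d(1))
  qed
  from this[OF order_refl \<open>0 \<le> T\<close>]
  obtain R where R: "0 \<le> R" "\<forall>t\<in>{0..T}. 0 \<le> t \<longrightarrow> (AE x in M. \<bar>u t x\<bar> \<le> R)"
    by (elim exE conjE)
  show ?thesis
  proof (rule that[OF R(1)])
    show "AE x in M. \<bar>u t x\<bar> \<le> R" if "t \<in> {0..T}" for t
      using R(2) that by simp
  qed
qed

section \<open>Borel versions of jointly measurable functions\<close>

text \<open>Intended for the equality of a Lebesgue measurable function with its Borel version,
  whose solution set need not be Borel, so that \<open>AE_commute\<close> does not apply. A null set
  of the product is instead carried over by the swap map and then sliced.\<close>

lemma AE_lborel_pair_swap:
  fixes P :: "'a::euclidean_space \<times> 'b::euclidean_space \<Rightarrow> bool"
  assumes "AE p in lborel \<Otimes>\<^sub>M lborel. P p"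
  shows "AE y in lborel. AE x in lborel. P (x, y)"
proof -
  have "AE p in distr (lborel \<Otimes>\<^sub>M lborel) (lborel \<Otimes>\<^sub>M lborel) (\<lambda>(y :: 'b, x :: 'a). (x, y)). P p"
    using assms by (subst lborel_pair.distr_pair_swap[symmetric])
  then have "AE q in lborel \<Otimes>\<^sub>M lborel. P ((\<lambda>(y :: 'b, x :: 'a). (x, y)) q)"
    by (rule AE_distrD[OF measurable_pair_swap'])
  from lborel_pair.AE_pair[OF this] show ?thesis by simp
qed

text \<open>A Borel function agreeing with \<open>v\<close> almost everywhere in
  \<open>(t, x)\<close> is sliced in both orders: fixing \<open>s\<close> serves the space integral
  over \<open>y\<close>, fixing \<open>x\<close> the time integral over \<open>s\<close>.\<close>

lemma joint_version_borel:
  fixes u v :: "real \<Rightarrow> real ^ 'n \<Rightarrow> real"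
  assumes v: "joint_version u v" and "0 \<le> R"
    and R: "\<And>t. t \<in> {0..T} \<Longrightarrow> AE x in lebesgue. \<bar>u t x\<bar> \<le> R"
  obtains g where "g \<in> borel_measurable (borel \<Otimes>\<^sub>M borel)" "\<And>p. \<bar>g p\<bar> \<le> R"
    "AE s in lborel. s \<in> {0..T} \<longrightarrow> (AE x in lborel. v s x = g (s, x))"
    "AE x in lborel. AE s in lborel. s \<in> {0..T} \<longrightarrow> v s x = g (s, x)"
proof -
  \<comment> \<open>Extension by 0 to negative times, since \<open>joint_version\<close> gives
    measurability only on the half-space.\<close>
  define h where "h p = (if p \<in> {0..} \<times> (UNIV :: (real^'n) set) then (\<lambda>(t, x). v t x) p else 0)" for p
  have "h \<in> borel_measurable lebesgue"
    unfolding h_def using v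
    by (subst borel_measurable_if) (simp_all add: joint_version_def borel_closed closed_Times)
  from completion_ex_borel_measurable_real[OF this]
  obtain g0 where g0: "g0 \<in> borel_measurable lborel" "AE p in lborel. h p = g0 p"
    by (elim bexE)
  have g0_meas [measurable]: "g0 \<in> borel_measurable (borel \<Otimes>\<^sub>M borel)"
    using g0(1) by (simp add: borel_prod)
  have ae: "AE p in lborel \<Otimes>\<^sub>M lborel. h p = g0 p"
    by (subst lborel_prod) (rule g0(2))
  have vR: "AE x in lborel. \<bar>v s x\<bar> \<le> R" if "s \<in> {0..T}" for s
  proof -
    have "AE x in lebesgue. v s x = u s x" using v that by (simp add: joint_version_def)
    with R[OF that] have "AE x in lebesgue. \<bar>v s x\<bar> \<le> R" by eventually_elim simp
    then show ?thesis by (simp add: AE_completion_iff)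
  qed
  have 1: "AE s in lborel. s \<in> {0..T} \<longrightarrow> (AE x in lborel. v s x = g0 (s, x) \<and> \<bar>g0 (s, x)\<bar> \<le> R)"
    using lborel_pair.AE_pair[OF ae]
  proof eventually_elim
    case (elim s)
    show ?case
    proof
      assume s: "s \<in> {0..T}"
      show "AE x in lborel. v s x = g0 (s, x) \<and> \<bar>g0 (s, x)\<bar> \<le> R"
        using elim vR[OF s] by eventually_elim (use s in \<open>auto simp: h_def\<close>)
    qed
  qed
  then have "AE s in lborel. AE x in lborel. s \<in> {0..T} \<longrightarrow> \<bar>g0 (s, x)\<bar> \<le> R"
  proof eventually_elim
    case (elim s)
    show ?case
    proof (cases "s \<in> {0..T}")
      case True
      with elim have "AE x in lborel. v s x = g0 (s, x) \<and> \<bar>g0 (s, x)\<bar> \<le> R" by blast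
      then show ?thesis by eventually_elim simp
    next
      case False
      then show ?thesis by (intro AE_I2) blast
    qed
  qed
  moreover have "{p \<in> space (lborel \<Otimes>\<^sub>M lborel). fst p \<in> {0..T} \<longrightarrow> \<bar>g0 (fst p, snd p)\<bar> \<le> R}
      \<in> sets (lborel \<Otimes>\<^sub>M lborel)"
    by measurable
  ultimately have 2: "AE x in lborel. AE s in lborel. s \<in> {0..T} \<longrightarrow> \<bar>g0 (s, x)\<bar> \<le> R"
    by (subst (asm) lborel_pair.AE_commute)
  \<comment> \<open>For times in \<open>[0, T]\<close> the bound \<open>R\<close> already holds
    almost everywhere, so clipping changes only null sets there and makes the bound valid at every
    point.\<close>
  define g where "g p = clip R (g0 p)" for p
  show ?thesis
  proof
    show "g \<in> borel_measurable (borel \<Otimes>\<^sub>M borel)" unfolding g_def by measurable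
    show "\<bar>g p\<bar> \<le> R" for p unfolding g_def using \<open>0 \<le> R\<close> by (rule abs_clip_le)
    show "AE s in lborel. s \<in> {0..T} \<longrightarrow> (AE x in lborel. v s x = g (s, x))"
      using 1
    proof eventually_elim
      case (elim s)
      show ?case
      proof
        assume "s \<in> {0..T}"
        with elim have "AE x in lborel. v s x = g0 (s, x) \<and> \<bar>g0 (s, x)\<bar> \<le> R" by blast
        then show "AE x in lborel. v s x = g (s, x)"
          by eventually_elim (simp add: g_def clip_id)
      qed
    qed
    show "AE x in lborel. AE s in lborel. s \<in> {0..T} \<longrightarrow> v s x = g (s, x)"
      using AE_lborel_pair_swap[OF ae] 2
    proof eventually_elim
      case (elim x)
      then show ?case by eventually_elim (auto simp: g_def clip_id h_def)
    qed
  qed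
qed

section \<open>The clipped nonlinearity\<close>

text \<open>On \<open>[-R, R]\<close> the function \<open>k\<close> is Lipschitz and bounded, and so
  is its product with the difference of the arguments. As clipping is nonexpansive, both properties
  extend to all real arguments.\<close>

lemma clipped_kernel:
  fixes k K :: "real \<Rightarrow> real \<Rightarrow> real"
  assumes K_nonneg: "\<And>p q. 0 \<le> p \<Longrightarrow> 0 \<le> q \<Longrightarrow> K p q \<ge> 0"
    and K_mono: "\<And>p p' q q'. 0 \<le> p \<Longrightarrow> p \<le> p' \<Longrightarrow> 0 \<le> q \<Longrightarrow> q \<le> q' \<Longrightarrow> K p q \<le> K p' q'"
    and k_lip: "\<And>a b a' b'. \<bar>k a b - k a' b'\<bar> \<le>
           K (\<bar>a\<bar> + \<bar>a'\<bar>) (\<bar>b\<bar> + \<bar>b'\<bar>) * (\<bar>a - a'\<bar> + \<bar>b - b'\<bar>)"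
    and "0 \<le> R"
  obtains l C where
    "\<And>a b a' b'. \<bar>k (clip R a) (clip R b) * (clip R b - clip R a)
        - k (clip R a') (clip R b') * (clip R b' - clip R a')\<bar> \<le> l * (\<bar>a - a'\<bar> + \<bar>b - b'\<bar>)"
    "\<And>a b. \<bar>k (clip R a) (clip R b) * (clip R b - clip R a)\<bar> \<le> C"
proof -
  \<comment> \<open>For arguments in \<open>[-R, R]\<close> each sum of two absolute values is at
    most \<open>2 * R\<close>, so monotonicity of \<open>K\<close> yields this Lipschitz
    constant.\<close>
  define \<kappa> where "\<kappa> = K (2 * R) (2 * R)"
  define B where "B = \<bar>k 0 0\<bar> + \<kappa> * (2 * R)"
  have "0 \<le> \<kappa>" unfolding \<kappa>_def using \<open>0 \<le> R\<close> by (intro K_nonneg) auto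
  then have "0 \<le> B" using \<open>0 \<le> R\<close> by (simp add: B_def)
  have lip: "\<bar>k a b - k a' b'\<bar> \<le> \<kappa> * (\<bar>a - a'\<bar> + \<bar>b - b'\<bar>)"
    if "\<bar>a\<bar> \<le> R" "\<bar>b\<bar> \<le> R" "\<bar>a'\<bar> \<le> R" "\<bar>b'\<bar> \<le> R" for a b a' b'
  proof (rule order_trans[OF k_lip])
    show "K (\<bar>a\<bar> + \<bar>a'\<bar>) (\<bar>b\<bar> + \<bar>b'\<bar>) * (\<bar>a - a'\<bar> + \<bar>b - b'\<bar>) \<le> \<kappa> * (\<bar>a - a'\<bar> + \<bar>b - b'\<bar>)"
      unfolding \<kappa>_def using that by (intro mult_right_mono K_mono) auto
  qed
  have k_bound: "\<bar>k a b\<bar> \<le> B" if "\<bar>a\<bar> \<le> R" "\<bar>b\<bar> \<le> R" for a b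
  proof -
    have "\<bar>k a b - k 0 0\<bar> \<le> \<kappa> * (\<bar>a - 0\<bar> + \<bar>b - 0\<bar>)"
      using that \<open>0 \<le> R\<close> by (intro lip) auto
    also have "\<dots> \<le> \<kappa> * (2 * R)"
      using that \<open>0 \<le> \<kappa>\<close> by (intro mult_left_mono) auto
    finally show ?thesis by (simp add: B_def)
  qed
  note clip_bound = abs_clip_le[OF \<open>0 \<le> R\<close>]
  have diff_bound: "\<bar>clip R b - clip R a\<bar> \<le> 2 * R" for a b
    using clip_bound[of a] clip_bound[of b] by linarith
  show ?thesis
  proof
    fix a b a' b' :: real
    let ?p = "clip R a" and ?q = "clip R b" and ?p' = "clip R a'" and ?q' = "clip R b'"
    let ?D = "\<bar>a - a'\<bar> + \<bar>b - b'\<bar>"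
    have D: "\<bar>?p - ?p'\<bar> + \<bar>?q - ?q'\<bar> \<le> ?D"
      by (intro add_mono clip_nonexpansive)
    have split: "k ?p ?q * (?q - ?p) - k ?p' ?q' * (?q' - ?p')
        = (k ?p ?q - k ?p' ?q') * (?q - ?p) + k ?p' ?q' * ((?q - ?q') - (?p - ?p'))"
      by (simp add: algebra_simps)
    have "\<bar>k ?p ?q * (?q - ?p) - k ?p' ?q' * (?q' - ?p')\<bar>
        \<le> \<bar>k ?p ?q - k ?p' ?q'\<bar> * \<bar>?q - ?p\<bar> + \<bar>k ?p' ?q'\<bar> * \<bar>(?q - ?q') - (?p - ?p')\<bar>"
      unfolding split abs_mult[symmetric] by (rule abs_triangle_ineq)
    also have "\<dots> \<le> (\<kappa> * ?D) * (2 * R) + B * ?D"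
    proof (intro add_mono mult_mono diff_bound k_bound clip_bound)
      show "\<bar>k ?p ?q - k ?p' ?q'\<bar> \<le> \<kappa> * ?D"
        by (rule order_trans[OF lip[OF clip_bound clip_bound clip_bound clip_bound]
              mult_left_mono[OF D \<open>0 \<le> \<kappa>\<close>]])
      show "\<bar>?q - ?q' - (?p - ?p')\<bar> \<le> ?D" using D by linarith
    qed (use \<open>0 \<le> \<kappa>\<close> \<open>0 \<le> B\<close> in simp_all)
    finally show "\<bar>k ?p ?q * (?q - ?p) - k ?p' ?q' * (?q' - ?p')\<bar> \<le> (\<kappa> * (2 * R) + B) * ?D"
      by (simp add: algebra_simps)
    show "\<bar>k ?p ?q * (?q - ?p)\<bar> \<le> B * (2 * R)"
      unfolding abs_mult
      by (intro mult_mono diff_bound k_bound clip_bound \<open>0 \<le> B\<close> abs_ge_zero)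
  qed
qed

text \<open>
  \<open>J'\<close> and \<open>U\<close> are Borel versions of \<open>J\<close> and \<open>u0\<close>, so that the Picard iteration stays within
  jointly Borel functions and no exceptional null sets accumulate.
\<close>

locale nonlocal_problem =
  fixes \<Omega> :: "(real ^ 'n) set" and J J' :: "real ^ 'n \<Rightarrow> real" and k K :: "real \<Rightarrow> real \<Rightarrow> real"
    and u0 U \<psi> :: "real ^ 'n \<Rightarrow> real" and M :: real
  assumes \<Omega>_borel [measurable]: "\<Omega> \<in> sets borel"
    and J'_nonneg: "\<And>z. 0 \<le> J' z"
    and J'_borel [measurable]: "J' \<in> borel_measurable borel"
    and J'_integrable: "integrable lborel J'"
    and J_eq: "AE z in lborel. J z = J' z"
    and k_nonneg: "\<And>a b. 0 \<le> k a b"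
    and K_nonneg: "\<And>p q. 0 \<le> p \<Longrightarrow> 0 \<le> q \<Longrightarrow> K p q \<ge> 0"
    and K_mono: "\<And>p p' q q'. 0 \<le> p \<Longrightarrow> p \<le> p' \<Longrightarrow> 0 \<le> q \<Longrightarrow> q \<le> q' \<Longrightarrow> K p q \<le> K p' q'"
    and k_lip: "\<And>a b a' b'. \<bar>k a b - k a' b'\<bar> \<le>
           K (\<bar>a\<bar> + \<bar>a'\<bar>) (\<bar>b\<bar> + \<bar>b'\<bar>) * (\<bar>a - a'\<bar> + \<bar>b - b'\<bar>)"
    and U_borel [measurable]: "U \<in> borel_measurable borel"
    and U_bounded: "\<And>x. \<bar>U x\<bar> \<le> M"
    and U_eq: "AE x in lborel. u0 x = U x"
    and u0_outside: "AE x in lborel. x \<notin> \<Omega> \<longrightarrow> u0 x = \<psi> x"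
begin

definition F :: "real \<Rightarrow> real \<Rightarrow> real \<Rightarrow> real" where
  "F R a b = k (clip R a) (clip R b) * (clip R b - clip R a)"

lemma kernel:
  assumes "0 \<le> R"
  obtains l C where "nonlocal_kernel (F R) J' l C"
proof (rule clipped_kernel[of K k R])
  fix l C
  assume "\<And>a b a' b'. \<bar>k (clip R a) (clip R b) * (clip R b - clip R a)
        - k (clip R a') (clip R b') * (clip R b' - clip R a')\<bar> \<le> l * (\<bar>a - a'\<bar> + \<bar>b - b'\<bar>)"
    "\<And>a b. \<bar>k (clip R a) (clip R b) * (clip R b - clip R a)\<bar> \<le> C"
  then have "nonlocal_kernel (F R) J' l C"
    by unfold_locales (auto simp: F_def J'_nonneg J'_integrable)
  then show ?thesis by (rule that)
qed (use K_nonneg K_mono k_lip assms in auto)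

text \<open>Since \<open>h\<close> is bounded by \<open>R\<close>, clipping is inactive and the
  original operator reappears. The functions \<open>w\<close> and \<open>h\<close> may differ on a
  null set, but not at the point \<open>x\<close> of evaluation.\<close>

lemma nonlocal_op_eq:
  assumes "0 \<le> R" and h: "h \<in> borel_measurable borel" "\<And>y. \<bar>h y\<bar> \<le> R"
    and x: "w x = h x" and ae: "AE y in lborel. w y = h y"
  shows "nonlocal_op k J w x = nonlocal_kernel.G (F R) J' h x"
proof -
  obtain l C where "nonlocal_kernel (F R) J' l C" using kernel[OF \<open>0 \<le> R\<close>] .
  then interpret N: nonlocal_kernel "F R" J' l C .
  show ?thesis
    unfolding nonlocal_op_def N.G_def
  proof (rule integral_lebesgue_eq_lborel_AE)
    show "(\<lambda>y. F R (h x) (h y) * J' (x - y)) \<in> borel_measurable borel"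
      using h(1) by measurable
    show "AE y in lborel. k (w x) (w y) * (w y - w x) * J (x - y) = F R (h x) (h y) * J' (x - y)"
      using ae AE_lborel_reflect[OF J_eq, of x]
      by eventually_elim (simp add: x F_def clip_id h(2))
  qed
qed

lemma M_nonneg: "0 \<le> M"
  using U_bounded[of 0] by simp

text \<open>For \<open>a \<ge> M\<close> the clipped value of \<open>a\<close> is \<open>M\<close>,
  the largest value that \<open>clip M b\<close> can take; with \<open>k\<close> nonnegative this
  fixes the sign. The lower case is symmetric.\<close>

lemma F_upper: "M \<le> a \<Longrightarrow> F M a b \<le> 0"
  using k_nonneg M_nonneg by (auto simp: F_def clip_def intro!: mult_nonneg_nonpos)

lemma F_lower: "a \<le> - M \<Longrightarrow> 0 \<le> F M a b"
  using k_nonneg M_nonneg by (auto simp: F_def clip_def intro!: mult_nonneg_nonneg)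

section \<open>Existence of a bounded solution\<close>

theorem solution_exists: "\<exists>u. is_solution \<Omega> k J \<psi> u0 u"
proof -
  obtain l C where "nonlocal_kernel (F M) J' l C" using kernel[OF M_nonneg] .
  then interpret N: nonlocal_kernel "F M" J' l C .
  obtain u where u_borel [measurable]: "u \<in> borel_measurable (borel \<Otimes>\<^sub>M borel)"
    and fixpoint: "\<And>t x. 0 \<le> t \<Longrightarrow> u (t, x) = N.picard U \<Omega> u (t, x)"
    by (rule N.picard_fixpoint[OF U_borel \<Omega>_borel]) (rule that)
  let ?h = "\<lambda>x s. N.G (\<lambda>y. u (s, y)) x"
  have eq: "u (t, x) = U x + (LINT s:{0..t}|lborel. ?h x s)" if "0 \<le> t" "x \<in> \<Omega>" for t x
    using fixpoint[OF that(1), of x] that(2) by (simp add: N.picard_def)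
  have eq_out: "u (t, x) = U x" if "0 \<le> t" "x \<notin> \<Omega>" for t x
    using fixpoint[OF that(1), of x] that(2) by (simp add: N.picard_def)
  have h_borel: "?h x \<in> borel_measurable borel" for x by measurable
  \<comment> \<open>The equation at a fixed \<open>x\<close> is a scalar integral equation to which
    the barrier applies, once for \<open>u\<close> and once for \<open>- u\<close>.\<close>
  have u_bounded: "\<bar>u (t, x)\<bar> \<le> M" if "0 \<le> t" for t x
  proof (cases "x \<in> \<Omega>")
    case True
    have "u (t, x) \<le> M"
    proof (rule integral_equation_upper_barrier[where \<phi> = "\<lambda>t. u (t, x)" and c = "U x",
          OF h_borel N.G_bounded _ _ _ that])
      show "?h x s \<le> 0" if "M \<le> u (s, x)" for s
      proof -
        have "?h x s \<le> (LINT (y :: real ^ 'n)|lborel. 0)"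
          unfolding N.G_def using F_upper[OF that] J'_nonneg
          by (intro integral_mono_AE') (auto intro!: mult_nonpos_nonneg)
        then show ?thesis by simp
      qed
    qed (use eq[OF _ True] U_bounded[of x] in auto)
    moreover have "- u (t, x) \<le> M"
    proof (rule integral_equation_upper_barrier[where \<phi> = "\<lambda>t. - u (t, x)" and c = "- U x"
          and h = "\<lambda>s. - ?h x s", OF _ _ _ _ _ that])
      show "- ?h x s \<le> 0" if "M \<le> - u (s, x)" for s
        unfolding N.G_def using F_lower[of "u (s, x)"] that J'_nonneg
        by (auto intro!: integral_nonneg_AE AE_I2 mult_nonneg_nonneg)
      show "- u (s, x) = - U x + (LINT s:{0..s}|lborel. - ?h x s)" if "0 \<le> s" for s
        using eq[OF that True] by (simp add: set_lebesgue_integral_def)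
      show "\<bar>- ?h x s\<bar> \<le> C * N.mass" for s using N.G_bounded by simp
    qed (use U_bounded[of x] in auto)
    ultimately show ?thesis by linarith
  qed (use eq_out[OF that] U_bounded in simp)
  \<comment> \<open>The Lipschitz constant in time does not depend on \<open>x\<close>; this is what
    gives continuity in the supremum norm.\<close>
  have lip_le: "\<bar>u (t, x) - u (s, x)\<bar> \<le> C * N.mass * (t - s)" if "0 \<le> s" "s \<le> t" for s t x
  proof (cases "x \<in> \<Omega>")
    case True
    then have "u (t, x) - u (s, x) = (LINT r:{s..t}|lborel. ?h x r)"
      using eq set_integral_Icc_split[OF h_borel N.G_bounded, of 0 s t x] that by simp
    then show ?thesis
      using set_integral_Icc_bound[OF h_borel N.G_bounded that(2), of x] by simp
  next
    case False
    then show ?thesis using eq_out that N.C_nonneg N.mass_nonneg by simp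
  qed
  have lip: "\<bar>u (s, x) - u (t, x)\<bar> \<le> C * N.mass * \<bar>s - t\<bar>" if "0 \<le> s" "0 \<le> t" for s t x
    using lip_le[of s t x] lip_le[of t s x] that by (cases "s \<le> t") (auto simp: abs_minus_commute)
  have u_lebesgue: "(\<lambda>x. u (t, x)) \<in> borel_measurable lebesgue" for t
    by (intro measurable_completion) simp
  define v where "v t x = u (t, x)" for t x
  have "v \<in> C_Linf lebesgue"
    unfolding C_Linf_def Linf_def mem_Collect_eq
  proof (intro conjI allI impI)
    fix t :: real assume t: "0 \<le> t"
    show "v t \<in> borel_measurable lebesgue" unfolding v_def by (rule u_lebesgue)
    then have "Linf_norm lebesgue (v t) \<le> ereal M"
      by (rule Linf_norm_le) (simp add: v_def u_bounded[OF t])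
    then show "Linf_norm lebesgue (v t) < \<infinity>" by (rule le_less_trans) simp
    show "((\<lambda>s. Linf_norm lebesgue (\<lambda>x. v s x - v t x)) \<longlongrightarrow> 0) (at t within {0..})"
    proof (rule tendsto_sandwich)
      show "\<forall>\<^sub>F s in at t within {0..}. 0 \<le> Linf_norm lebesgue (\<lambda>x. v s x - v t x)"
        by (simp add: Linf_norm_lebesgue_nonneg)
      have "Linf_norm lebesgue (\<lambda>x. v s x - v t x) \<le> ereal (C * N.mass * \<bar>s - t\<bar>)" if "s \<in> {0..}" for s
        using that t u_lebesgue lip by (intro Linf_norm_le) (auto simp: v_def)
      then show "\<forall>\<^sub>F s in at t within {0..}.
          Linf_norm lebesgue (\<lambda>x. v s x - v t x) \<le> ereal (C * N.mass * \<bar>s - t\<bar>)"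
        by (auto simp: eventually_at_filter)
      have "((\<lambda>s. C * N.mass * \<bar>s - t\<bar>) \<longlongrightarrow> C * N.mass * \<bar>t - t\<bar>) (at t within {0..})"
        by (intro tendsto_intros)
      then show "((\<lambda>s. ereal (C * N.mass * \<bar>s - t\<bar>)) \<longlongrightarrow> 0) (at t within {0..})"
        by (simp add: zero_ereal_def)
    qed simp
  qed
  moreover have "AE x in lebesgue. x \<notin> \<Omega> \<longrightarrow> v t x = \<psi> x" if "0 \<le> t" for t
    using AE_completion[OF U_eq] AE_completion[OF u0_outside]
    by eventually_elim (use that in \<open>simp add: v_def eq_out\<close>)
  moreover have "AE x in lebesgue. v 0 x = u0 x"
    using AE_completion[OF U_eq]
  proof eventually_elim
    case (elim x)
    have "(LINT s:{0..0}|lborel. ?h x s) = 0"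
      using set_integral_Icc_bound[OF h_borel N.G_bounded, of 0 0] by simp
    then show ?case using elim eq[of 0 x] eq_out[of 0 x] by (cases "x \<in> \<Omega>") (auto simp: v_def)
  qed
  moreover have "joint_version v v"
  proof -
    have "u \<in> borel_measurable lebesgue"
      using u_borel by (intro measurable_completion) (simp add: borel_prod)
    then show ?thesis
      by (simp add: joint_version_def v_def measurable_restrict_space1)
  qed
  moreover have "AE x in lebesgue. x \<in> \<Omega> \<longrightarrow>
      v t x = u0 x + (LINT s:{0..t}|lebesgue. nonlocal_op k J (v s) x)" if "0 \<le> t" for t
    using AE_completion[OF U_eq]
  proof eventually_elim
    case (elim x)
    have "(LINT s:{0..t}|lebesgue. nonlocal_op k J (v s) x) = (LINT s:{0..t}|lborel. ?h x s)"
      unfolding set_lebesgue_integral_def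
    proof (rule integral_lebesgue_eq_lborel_AE)
      show "(\<lambda>s. indicator {0..t} s *\<^sub>R ?h x s) \<in> borel_measurable borel"
        using h_borel by simp
      \<comment> \<open>The a priori bound \<open>M\<close> enters here: it makes clipping inactive,
        so the fixed point solves the original equation.\<close>
      have "nonlocal_op k J (v s) x = ?h x s" if "0 \<le> s" for s
        by (rule nonlocal_op_eq[OF M_nonneg]) (auto simp: v_def u_bounded that)
      then show "AE s in lborel. indicator {0..t} s *\<^sub>R nonlocal_op k J (v s) x
          = indicator {0..t} s *\<^sub>R ?h x s"
        by (auto simp: indicator_def)
    qed
    then show ?case using elim eq[OF that] by (simp add: v_def)
  qed
  ultimately have "is_solution \<Omega> k J \<psi> u0 v"
    unfolding is_solution_def by (intro conjI allI impI exI[of _ v])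
  then show ?thesis by blast
qed

section \<open>Uniqueness through Borel versions\<close>

text \<open>Fubini identifies \<open>u s\<close> with its Borel version \<open>g\<close> only for
  almost every \<open>s\<close>. The integral equation sees \<open>g\<close> only under the time
  integral, and therefore expresses \<open>u t\<close> through \<open>g\<close> for every
  \<open>t\<close>.\<close>

lemma solution_borel_version:
  assumes sol: "is_solution \<Omega> k J \<psi> u0 u" and "0 \<le> R"
    and R: "\<And>t. t \<in> {0..T} \<Longrightarrow> AE x in lebesgue. \<bar>u t x\<bar> \<le> R"
  obtains g where "g \<in> borel_measurable (borel \<Otimes>\<^sub>M borel)"
    "AE s in lborel. s \<in> {0..T} \<longrightarrow> (AE x in lborel. u s x = g (s, x))"
    "\<And>t. t \<in> {0..T} \<Longrightarrow> AE x in lborel. u t x = nonlocal_kernel.picard (F R) J' U \<Omega> g (t, x)"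
proof -
  obtain l C where "nonlocal_kernel (F R) J' l C" using kernel[OF \<open>0 \<le> R\<close>] .
  then interpret N: nonlocal_kernel "F R" J' l C .
  obtain v where v: "joint_version u v"
    and v_eq: "\<And>t. 0 \<le> t \<Longrightarrow> AE x in lebesgue. x \<in> \<Omega> \<longrightarrow>
           v t x = u0 x + (LINT s:{0..t}|lebesgue. nonlocal_op k J (v s) x)"
    using sol unfolding is_solution_def by blast
  have uv: "AE x in lborel. v t x = u t x" if "0 \<le> t" for t
    using v that by (simp add: joint_version_def AE_completion_iff)
  obtain g where g_borel [measurable]: "g \<in> borel_measurable (borel \<Otimes>\<^sub>M borel)"
    and g_bounded: "\<And>p. \<bar>g p\<bar> \<le> R"
    and g1: "AE s in lborel. s \<in> {0..T} \<longrightarrow> (AE x in lborel. v s x = g (s, x))"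
    and g2: "AE x in lborel. AE s in lborel. s \<in> {0..T} \<longrightarrow> v s x = g (s, x)"
    by (rule joint_version_borel[where T = T, OF v \<open>0 \<le> R\<close>], erule R, rule that)
  \<comment> \<open>For a good \<open>x\<close> and almost every \<open>s\<close>, \<open>g2\<close>
    gives agreement at the point \<open>x\<close> and \<open>g1\<close> agreement for almost every
    \<open>y\<close>, the two inputs of \<open>nonlocal_op_eq\<close>.\<close>
  have op: "AE x in lborel. AE s in lborel. s \<in> {0..T} \<longrightarrow>
      nonlocal_op k J (v s) x = N.G (\<lambda>y. g (s, y)) x"
    using g2
  proof eventually_elim
    case (elim x)
    then show ?case
      using g1
    proof eventually_elim
      case (elim s)
      show ?case
        using elim g_bounded by (intro impI nonlocal_op_eq[OF \<open>0 \<le> R\<close>]) auto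
    qed
  qed
  show ?thesis
  proof
    show "g \<in> borel_measurable (borel \<Otimes>\<^sub>M borel)" by (rule g_borel)
    show "AE s in lborel. s \<in> {0..T} \<longrightarrow> (AE x in lborel. u s x = g (s, x))"
      using g1
    proof eventually_elim
      case (elim s)
      show ?case
      proof
        assume s: "s \<in> {0..T}"
        with elim have "AE x in lborel. v s x = g (s, x)" by blast
        moreover have "AE x in lborel. v s x = u s x" using s by (intro uv) simp
        ultimately show "AE x in lborel. u s x = g (s, x)" by eventually_elim simp
      qed
    qed
    fix t assume t: "t \<in> {0..T}"
    then have "0 \<le> t" by simp
    have "AE x in lborel. x \<notin> \<Omega> \<longrightarrow> u t x = \<psi> x"
      using sol \<open>0 \<le> t\<close> by (simp add: is_solution_def AE_completion_iff)
    moreover have "AE x in lborel. x \<in> \<Omega> \<longrightarrow>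
           v t x = u0 x + (LINT s:{0..t}|lebesgue. nonlocal_op k J (v s) x)"
      using v_eq[OF \<open>0 \<le> t\<close>] by (simp add: AE_completion_iff)
    ultimately show "AE x in lborel. u t x = N.picard U \<Omega> g (t, x)"
      using uv[OF \<open>0 \<le> t\<close>] op U_eq u0_outside
    proof eventually_elim
      case (elim x)
      have "(LINT s:{0..t}|lebesgue. nonlocal_op k J (v s) x)
          = (LINT s:{0..t}|lborel. N.G (\<lambda>y. g (s, y)) x)"
        unfolding set_lebesgue_integral_def
      proof (rule integral_lebesgue_eq_lborel_AE)
        show "(\<lambda>s. indicator {0..t} s *\<^sub>R N.G (\<lambda>y. g (s, y)) x) \<in> borel_measurable borel"
          by measurable
        show "AE s in lborel. indicator {0..t} s *\<^sub>R nonlocal_op k J (v s) x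
            = indicator {0..t} s *\<^sub>R N.G (\<lambda>y. g (s, y)) x"
          using elim(4) by eventually_elim (use t in \<open>auto simp: indicator_def\<close>)
      qed
      then show ?case using elim by (auto simp: N.picard_def)
    qed
  qed
qed

theorem solution_unique:
  assumes u: "is_solution \<Omega> k J \<psi> u0 u" and w: "is_solution \<Omega> k J \<psi> u0 w" and "0 \<le> T"
  shows "AE x in lebesgue. u T x = w T x"
proof -
  have Linf: "u \<in> C_Linf lebesgue" "w \<in> C_Linf lebesgue"
    using u w by (simp_all add: is_solution_def)
  obtain R1 where R1: "0 \<le> R1" "\<And>t. t \<in> {0..T} \<Longrightarrow> AE x in lebesgue. \<bar>u t x\<bar> \<le> R1"
    by (rule C_Linf_bounded_Icc[OF Linf(1) \<open>0 \<le> T\<close>]) (rule that)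
  obtain R2 where R2: "0 \<le> R2" "\<And>t. t \<in> {0..T} \<Longrightarrow> AE x in lebesgue. \<bar>w t x\<bar> \<le> R2"
    by (rule C_Linf_bounded_Icc[OF Linf(2) \<open>0 \<le> T\<close>]) (rule that)
  define R where "R = max R1 R2"
  have "0 \<le> R" using R1(1) by (simp add: R_def)
  have Ru: "AE x in lebesgue. \<bar>u t x\<bar> \<le> R" if "t \<in> {0..T}" for t
    using R1(2)[OF that] by eventually_elim (simp add: R_def)
  have Rw: "AE x in lebesgue. \<bar>w t x\<bar> \<le> R" if "t \<in> {0..T}" for t
    using R2(2)[OF that] by eventually_elim (simp add: R_def)
  obtain l C where "nonlocal_kernel (F R) J' l C" using kernel[OF \<open>0 \<le> R\<close>] .
  then interpret N: nonlocal_kernel "F R" J' l C .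
  obtain f where f: "f \<in> borel_measurable (borel \<Otimes>\<^sub>M borel)"
    "AE s in lborel. s \<in> {0..T} \<longrightarrow> (AE x in lborel. u s x = f (s, x))"
    "\<And>t. t \<in> {0..T} \<Longrightarrow> AE x in lborel. u t x = N.picard U \<Omega> f (t, x)"
    by (rule solution_borel_version[where T = T, OF u \<open>0 \<le> R\<close>], erule Ru, rule that)
  obtain g where g: "g \<in> borel_measurable (borel \<Otimes>\<^sub>M borel)"
    "AE s in lborel. s \<in> {0..T} \<longrightarrow> (AE x in lborel. w s x = g (s, x))"
    "\<And>t. t \<in> {0..T} \<Longrightarrow> AE x in lborel. w t x = N.picard U \<Omega> g (t, x)"
    by (rule solution_borel_version[where T = T, OF w \<open>0 \<le> R\<close>], erule Rw, rule that)
  \<comment> \<open>The induction is on solutions at every \<open>t\<close>. Its step passes to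
    \<open>f\<close> and \<open>g\<close> for almost every time, contracts, and returns to
    \<open>u\<close> and \<open>w\<close> at every \<open>t\<close> by \<open>f(3)\<close> and
    \<open>g(3)\<close>. The start is the crude bound \<open>2 * R\<close>.\<close>
  have bound: "AE x in lborel. \<bar>u t x - w t x\<bar> \<le> 2 * R / 2 ^ n * exp (2 * N.L * t)" if "t \<in> {0..T}" for n t
    using that
  proof (induction n arbitrary: t)
    case 0
    have "1 \<le> exp (2 * N.L * t)" using 0 N.L_ge_1 by simp
    then have "2 * R * 1 \<le> 2 * R * exp (2 * N.L * t)"
      using \<open>0 \<le> R\<close> by (intro mult_left_mono) auto
    moreover have "AE x in lborel. \<bar>u t x\<bar> \<le> R" "AE x in lborel. \<bar>w t x\<bar> \<le> R"
      using Ru[OF 0] Rw[OF 0] by (simp_all add: AE_completion_iff)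
    ultimately show ?case
      by (elim eventually_rev_mp) (intro AE_I2 impI, auto)
  next
    case (Suc n)
    have "AE s in lborel. s \<in> {0..T} \<longrightarrow>
        (AE x in lborel. \<bar>f (s, x) - g (s, x)\<bar> \<le> 2 * R / 2 ^ n * exp (2 * N.L * s))"
      using f(2) g(2)
    proof eventually_elim
      case (elim s)
      show ?case
      proof
        assume s: "s \<in> {0..T}"
        with elim have "AE x in lborel. u s x = f (s, x)" "AE x in lborel. w s x = g (s, x)" by blast+
        with Suc.IH[OF s]
        show "AE x in lborel. \<bar>f (s, x) - g (s, x)\<bar> \<le> 2 * R / 2 ^ n * exp (2 * N.L * s)"
          by eventually_elim simp
      qed
    qed
    then have "AE x in lborel. \<forall>t\<in>{0..T}. \<bar>N.picard U \<Omega> f (t, x) - N.picard U \<Omega> g (t, x)\<bar>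
        \<le> 2 * R / 2 ^ n / 2 * exp (2 * N.L * t)"
      using \<open>0 \<le> R\<close> by (intro N.picard_contraction_AE f(1) g(1)) auto
    with f(3)[OF Suc.prems] g(3)[OF Suc.prems] show ?case
    proof eventually_elim
      case (elim x)
      then have "\<bar>u t x - w t x\<bar> \<le> 2 * R / 2 ^ n / 2 * exp (2 * N.L * t)"
        using Suc.prems by simp
      then show ?case by (simp add: mult.commute)
    qed
  qed
  have "AE x in lborel. \<forall>n. \<bar>u T x - w T x\<bar> \<le> 2 * R / 2 ^ n * exp (2 * N.L * T)"
    using bound \<open>0 \<le> T\<close> by (intro AE_all_countable[THEN iffD2] allI) auto
  then have "AE x in lborel. u T x = w T x"
  proof eventually_elim
    case (elim x)
    have "(\<lambda>n. 2 * R / 2 ^ n * exp (2 * N.L * T)) \<longlonglongrightarrow> 0 * exp (2 * N.L * T)"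
      by (intro tendsto_intros LIMSEQ_divide_realpow_zero) simp
    then have "\<bar>u T x - w T x\<bar> \<le> 0 * exp (2 * N.L * T)"
      by (rule LIMSEQ_le_const) (use elim in auto)
    then show ?case by simp
  qed
  then show ?thesis by (rule AE_completion)
qed

end

section \<open>Reduction of the given data to Borel data\<close>

theorem theorem5p1:
  fixes \<Omega> :: "(real ^ 'n) set"
    and J :: "real ^ 'n \<Rightarrow> real"
    and k K :: "real \<Rightarrow> real \<Rightarrow> real"
    and u0 \<psi> :: "real ^ 'n \<Rightarrow> real"
  assumes "open \<Omega>" and "bounded \<Omega>"
    and "\<And>z. J z \<ge> 0" and "integrable lebesgue J"
    and "\<And>z. norm z < 1 \<Longrightarrow> J z > 0" and "\<And>z. norm z \<ge> 1 \<Longrightarrow> J z = 0"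
    and "\<And>a b. k a b \<ge> 0"
    and "\<And>p q. 0 \<le> p \<Longrightarrow> 0 \<le> q \<Longrightarrow> K p q \<ge> 0"
    and "\<And>p p' q q'. 0 \<le> p \<Longrightarrow> p \<le> p' \<Longrightarrow> 0 \<le> q \<Longrightarrow> q \<le> q' \<Longrightarrow> K p q \<le> K p' q'"
    and "continuous_on ({0..} \<times> {0..}) (\<lambda>(p, q). K p q)"
    and "\<And>a b a' b'. \<bar>k a b - k a' b'\<bar> \<le>
           K (\<bar>a\<bar> + \<bar>a'\<bar>) (\<bar>b\<bar> + \<bar>b'\<bar>) * (\<bar>a - a'\<bar> + \<bar>b - b'\<bar>)"
    and "u0 \<in> Linf lebesgue" and "\<psi> \<in> Linf (lebesgue_on (- \<Omega>))"
    and "AE x in lebesgue. x \<notin> \<Omega> \<longrightarrow> u0 x = \<psi> x"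
  shows "(\<exists>u. is_solution \<Omega> k J \<psi> u0 u) \<and>
    (\<forall>u w. is_solution \<Omega> k J \<psi> u0 u \<longrightarrow> is_solution \<Omega> k J \<psi> u0 w \<longrightarrow>
       (\<forall>t\<ge>0. AE x in lebesgue. u t x = w t x))"
proof -
  obtain J1 where J1: "J1 \<in> borel_measurable lborel" "AE z in lborel. J z = J1 z"
    using completion_ex_borel_measurable_real[OF borel_measurable_integrable[OF assms(4)]]
    by (elim bexE)
  \<comment> \<open>A Borel version of \<open>J\<close> may be negative on a null set; the maximum
    restores nonnegativity at every point.\<close>
  define J' where "J' z = max 0 (J1 z)" for z
  have J'_borel: "J' \<in> borel_measurable borel"
    using J1(1) unfolding J'_def by simp
  have J_eq: "AE z in lborel. J z = J' z"
    using J1(2) by eventually_elim (use assms(3) in \<open>metis J'_def max.absorb2\<close>)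
  have "integrable lebesgue J'"
    using assms(4) by (rule integrable_cong_AE_imp)
      (use J'_borel AE_completion[OF J_eq] in \<open>auto intro!: measurable_completion\<close>)
  then have J'_integrable: "integrable lborel J'"
    using J'_borel by (simp add: integrable_completion)
  obtain M where M: "0 \<le> M" "AE x in lebesgue. \<bar>u0 x\<bar> \<le> M"
    using Linf_AE_bounded[OF assms(12)] .
  have "u0 \<in> borel_measurable lebesgue" using assms(12) by (simp add: Linf_def)
  then obtain U1 where U1: "U1 \<in> borel_measurable lborel" "AE x in lborel. u0 x = U1 x"
    using completion_ex_borel_measurable_real by (elim bexE[OF completion_ex_borel_measurable_real])
  \<comment> \<open>Clipping turns the essential bound on \<open>u0\<close> into a bound at every
    point, as the pointwise barrier argument requires.\<close>
  define U where "U x = clip M (U1 x)" for x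
  have U_eq: "AE x in lborel. u0 x = U x"
    using U1(2) M(2)[unfolded AE_completion_iff] by eventually_elim (simp add: U_def clip_id)
  have "nonlocal_problem \<Omega> J J' k K u0 U \<psi> M"
  proof
    show "U \<in> borel_measurable borel" unfolding U_def using U1(1) by simp
    show "\<bar>U x\<bar> \<le> M" for x unfolding U_def using M(1) by (rule abs_clip_le)
    show "AE x in lborel. x \<notin> \<Omega> \<longrightarrow> u0 x = \<psi> x" using assms(14) by (simp add: AE_completion_iff)
  qed (use assms(1,7,8,9,11) J'_borel J'_integrable J_eq U_eq in \<open>auto simp: J'_def\<close>)
  then interpret nonlocal_problem \<Omega> J J' k K u0 U \<psi> M .
  show ?thesis
    using solution_exists solution_unique by blast
qed

end
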